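(* Let $A\in\mathbb{R}^{d\times d}$ be a matrix with $\sum_{i=1}^d A_{i,i}^2>0$, let $N$ be a positive integer, let $u^{(1)},\dots,u^{(N)}$ be independent random vectors with $u^{(j)}\sim\mathcal{N}(0,I_d)$, and let $g\in\mathbb{R}^d$ be the random vector $$g=\frac{1}{2N}\sum_{j=1}^{N}\big[u^{(j)}\big]^\top A\,u^{(j)}\cdot\Big([u^{(j)}]^2-\mathbf{1}_d\Big).$$ Let $0<\delta<1$ and $\varepsilon>0$. If $$N=\frac{1}{4\varepsilon\delta}\cdot\frac{(4d+16)\big(\mathrm{tr}(A)\big)^2+(d+8)\|A+A^\top\|^2+20\sum_{i=1}^{d}A_{i,i}^2}{\sum_{i=1}^{d}A_{i,i}^2},$$ then with probability at least $1-\delta$, $$\|g-\mathrm{diag}(A)\|^2\le\varepsilon\sum_{i=1}^{d}A_{i,i}^2.$$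
   Context: $A$ is an arbitrary deterministic real $d\times d$ matrix (not assumed symmetric or positive semidefinite). $A_{i,j}$ is the $(i,j)$ entry, and $\mathrm{diag}(A)=[A_{1,1},\dots,A_{d,d}]^\top\in\mathbb{R}^d$. For a matrix $M$, $\|M\|=\sqrt{\mathrm{tr}(M^\top M)}$ is the Frobenius norm; for a vector, $\|\cdot\|$ is the Euclidean norm. For a vector $u$, $[u]^2$ is the entrywise square, and $\mathbf{1}_d$ is the all-ones vector in $\mathbb{R}^d$. The vector $g$ is the output of the stochastic diagonal estimation algorithm that accesses $A$ only through the quadratic forms $u^\top A u$ at $N$ independent standard Gaussian vectors. *)

theory Defs
  imports "HOL-Probability.Probability"
begin

text \<open>The density of \<open>N(0, I\<^sub>d)\<close> with respect to Lebesgue measure on \<open>real ^ 'd\<close>.\<close>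

definition std_normal_vec_density :: "real ^ 'd \<Rightarrow> real" where
  "std_normal_vec_density x = 1 / sqrt ((2 * pi) ^ CARD('d)) * exp (- (norm x)\<^sup>2 / 2)"

lemma std_normal_vec_density_eq_prod:
  "std_normal_vec_density (x :: real ^ 'd) = (\<Prod>i\<in>UNIV. std_normal_density (x $ i))"
proof -
  have "(norm x)\<^sup>2 = (\<Sum>i\<in>UNIV. (x $ i)\<^sup>2)"
    by (simp add: norm_vec_def L2_set_def sum_nonneg)
  then show ?thesis
    by (simp add: std_normal_vec_density_def std_normal_density_def prod.distrib prod_dividef
        exp_sum [symmetric] sum_negf sum_divide_distrib real_sqrt_mult real_sqrt_power power_mult_distrib)
qed

definition frobenius_norm :: "real ^ 'd ^ 'd \<Rightarrow> real" where
  "frobenius_norm M = sqrt (trace (transpose M ** M))"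

lemma frobenius_norm_eq_norm: "frobenius_norm M = norm M"
proof -
  have "trace (transpose M ** M) = (\<Sum>i\<in>UNIV. \<Sum>j\<in>UNIV. (M $ j $ i)\<^sup>2)"
    by (simp add: trace_def matrix_matrix_mult_def transpose_def power2_eq_square)
  also have "\<dots> = (\<Sum>j\<in>UNIV. \<Sum>i\<in>UNIV. (M $ j $ i)\<^sup>2)"
    by (rule sum.swap)
  finally show ?thesis
    by (simp add: frobenius_norm_def norm_vec_def L2_set_def sum_nonneg)
qed

definition diag_vec :: "real ^ 'd ^ 'd \<Rightarrow> real ^ 'd" where
  "diag_vec A = (\<chi> i. A $ i $ i)"

definition diag_estimator :: "real ^ 'd ^ 'd \<Rightarrow> nat \<Rightarrow> (nat \<Rightarrow> real ^ 'd) \<Rightarrow> real ^ 'd" where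
  "diag_estimator A N v =
     (1 / (2 * real N)) *\<^sub>R (\<Sum>j=1..N. (v j \<bullet> (A *v v j)) *\<^sub>R (\<chi> i. (v j $ i)\<^sup>2 - 1))"

end

theory Submission
  imports Defs "HOL-Computational_Algebra.Polynomial"
begin

text \<open>
  By Markov's inequality and independence it suffices to bound the variance of one summand
  \<open>(x \<bullet> A x) (x\<^sub>i\<^sup>2 - 1)\<close>, \<open>x \<sim> N(0, I)\<close>. Stein's identity \<open>E (x\<^sub>k f) = E (\<partial>\<^sub>k f)\<close> peels
  the variables \<open>x\<^sub>k\<close> off \<open>x\<^sub>k x\<^sub>l x\<^sub>m x\<^sub>n p(x\<^sub>i)\<close> one at a time (Wick's rule), leaving Kronecker
  deltas times the one-dimensional means of \<open>p\<close> and its second and fourth derivatives. With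
  \<open>p(t) = (t\<^sup>2 - 1)\<^sup>2\<close> these are 2, 8 and 24, and contracting the deltas with \<open>A \<otimes> A\<close> gives
  the second moment exactly. The resulting coefficient of \<open>(tr A)\<^sup>2\<close> is \<open>2 d + 16\<close>, so the
  \<open>4 d + 16\<close> in the theorem leaves slack.
\<close>

section \<open>Integration of coordinatewise products under Lebesgue and Gaussian measure\<close>

lemma
  fixes f :: "'d::finite \<Rightarrow> real \<Rightarrow> real"
  assumes f: "\<And>i. integrable lborel (f i)"
  shows integrable_lborel_vec_prod: "integrable lborel (\<lambda>x :: real ^ 'd. \<Prod>i\<in>UNIV. f i (x $ i))"
    and integral_lborel_vec_prod:
      "integral\<^sup>L lborel (\<lambda>x :: real ^ 'd. \<Prod>i\<in>UNIV. f i (x $ i)) = (\<Prod>i\<in>UNIV. \<integral>t. f i t \<partial>lborel)"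
proof -
  interpret product_sigma_finite "\<lambda>b :: real ^ 'd. lborel :: real measure" ..
  have [measurable]: "f i \<in> borel_measurable borel" for i
    using borel_measurable_integrable[OF f[of i]] by simp
  \<comment> \<open>\<open>lborel_eq\<close> presents Lebesgue measure as the image of a product
    measure indexed by the vectors in \<open>Basis\<close>. This bijection renames those factors by
    coordinates, so that Fubini for finite products applies.\<close>
  have bij: "bij_betw (\<lambda>i :: 'd. axis i (1::real)) UNIV Basis"
    by (auto simp: bij_betw_def inj_on_def axis_eq_axis Basis_vec_def)
  have reindex: "(\<Prod>b\<in>Basis. h (axis_index b) b) = (\<Prod>i\<in>UNIV. h i (axis i (1::real)))"
    for h :: "'d \<Rightarrow> real ^ 'd \<Rightarrow> real"
    using prod.reindex_bij_betw[OF bij, of "\<lambda>b. h (axis_index b) b"] by (simp add: axis_index_axis)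
  have comp: "(\<Sum>b\<in>Basis. y b *\<^sub>R b) $ i = y (axis i 1)" for y :: "real ^ 'd \<Rightarrow> real" and i
    by (simp add: cart_eq_inner_axis inner_sum_left_Basis)
  have push: "(\<Prod>i\<in>UNIV. f i ((\<Sum>b\<in>Basis. y b *\<^sub>R b) $ i)) = (\<Prod>b\<in>Basis. f (axis_index b) (y b))"
    for y :: "real ^ 'd \<Rightarrow> real"
    unfolding comp by (rule reindex[symmetric])
  show "integrable lborel (\<lambda>x :: real ^ 'd. \<Prod>i\<in>UNIV. f i (x $ i))"
    by (subst lborel_eq, subst integrable_distr_eq)
      (simp_all add: push del: sum_component, intro product_integrable_prod f finite_Basis)
  show "integral\<^sup>L lborel (\<lambda>x :: real ^ 'd. \<Prod>i\<in>UNIV. f i (x $ i)) = (\<Prod>i\<in>UNIV. \<integral>t. f i t \<partial>lborel)"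
    by (subst lborel_eq, subst integral_distr)
      (simp_all add: push product_integral_prod[OF finite_Basis f]
        reindex[of "\<lambda>i b. \<integral>t. f i t \<partial>lborel"] del: sum_component)
qed

abbreviation std_normal_vec :: "(real ^ 'd) measure" where
  "std_normal_vec \<equiv> density lborel (\<lambda>x. ennreal (std_normal_vec_density x))"

lemma std_normal_vec_density_measurable [measurable]:
  "std_normal_vec_density \<in> borel_measurable borel"
  unfolding std_normal_vec_density_def [abs_def] by measurable

lemma std_normal_vec_density_nonneg [simp]: "0 \<le> std_normal_vec_density x"
  by (simp add: std_normal_vec_density_def)

text \<open>The Gaussian density is itself a product over coordinates, so it can be absorbed into
  the factors and the Lebesgue version applies to
  \<open>std_normal_density t * f i t\<close>.\<close>

lemma
  fixes f :: "'d::finite \<Rightarrow> real \<Rightarrow> real"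
  assumes f: "\<And>i. integrable std_normal_distribution (f i)"
  shows integrable_std_normal_vec_prod: "integrable std_normal_vec (\<lambda>x :: real ^ 'd. \<Prod>i\<in>UNIV. f i (x $ i))"
    and integral_std_normal_vec_prod:
      "integral\<^sup>L std_normal_vec (\<lambda>x :: real ^ 'd. \<Prod>i\<in>UNIV. f i (x $ i)) =
        (\<Prod>i\<in>UNIV. \<integral>t. f i t \<partial>std_normal_distribution)"
proof -
  have meas [measurable]: "f i \<in> borel_measurable borel" for i
    using borel_measurable_integrable[OF f[of i]] by simp
  have int: "integrable lborel (\<lambda>t. std_normal_density t * f i t)" for i
    using f[of i] by (simp add: integrable_density)
  show "integrable std_normal_vec (\<lambda>x :: real ^ 'd. \<Prod>i\<in>UNIV. f i (x $ i))"
    using integrable_lborel_vec_prod[OF int]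
    by (simp add: integrable_density std_normal_vec_density_eq_prod prod_nonneg prod.distrib)
  show "integral\<^sup>L std_normal_vec (\<lambda>x :: real ^ 'd. \<Prod>i\<in>UNIV. f i (x $ i)) =
        (\<Prod>i\<in>UNIV. \<integral>t. f i t \<partial>std_normal_distribution)"
    using integral_lborel_vec_prod[OF int]
    by (simp add: integral_density std_normal_vec_density_eq_prod prod_nonneg prod.distrib)
qed

section \<open>Stein's identity in one dimension\<close>

lemma integrable_std_normal_power: "integrable std_normal_distribution (\<lambda>x. x ^ n)"
  using integrable_std_normal_moment[of n] by (simp add: integrable_density)

lemma integrable_std_normal_poly: "integrable std_normal_distribution (poly p)"
  unfolding poly_altdef [abs_def]
  by (intro Bochner_Integration.integrable_sum integrable_mult_right integrable_std_normal_power)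

text \<open>Read off from the closed moment formulas: odd moments vanish, and the even moment of
  order \<open>2 * Suc k\<close> is \<open>2 * k + 1\<close> times that of order
  \<open>2 * k\<close>. For \<open>n = 0\<close> the factor \<open>real n\<close> makes the
  truncated exponent \<open>n - 1\<close> harmless.\<close>

lemma stein_power:
  "(\<integral>x. x ^ Suc n \<partial>std_normal_distribution) = real n * (\<integral>x. x ^ (n - 1) \<partial>std_normal_distribution)"
proof (cases n)
  case 0
  then show ?thesis
    using integral_std_normal_moment_odd[of 0] by (simp add: integral_density)
next
  case (Suc m)
  show ?thesis
  proof (cases "even m")
    case True
    then obtain k where "m = 2 * k" by (rule evenE)
    moreover have "fact (2 * Suc k) / (2 ^ Suc k * fact (Suc k)) = real (Suc (2 * k)) * (fact (2 * k) / (2 ^ k * fact k))"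
      by (simp add: divide_simps)
    ultimately show ?thesis
      using Suc integral_std_normal_moment_even[of k] integral_std_normal_moment_even[of "Suc k"]
      by (simp add: integral_density)
  next
    case False
    then obtain k where "m = 2 * k + 1" by (rule oddE)
    then show ?thesis
      using Suc integral_std_normal_moment_odd[of k] integral_std_normal_moment_odd[of "Suc k"]
      by (simp add: integral_density)
  qed
qed

text \<open>The linear extension of \<open>stein_power\<close> from monomials to
  polynomials.\<close>

lemma stein_poly:
  "(\<integral>x. x * poly p x \<partial>std_normal_distribution) = (\<integral>x. poly (pderiv p) x \<partial>std_normal_distribution)"
proof -
  note int = integrable_std_normal_power
  have "(\<integral>x. x * poly p x \<partial>std_normal_distribution)
      = (\<integral>x. (\<Sum>i\<le>degree p. coeff p i * x ^ Suc i) \<partial>std_normal_distribution)"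
    by (simp add: poly_altdef sum_distrib_left mult_ac)
  also have "\<dots> = (\<Sum>i\<le>degree p. coeff p i * (\<integral>x. x ^ Suc i \<partial>std_normal_distribution))"
    using int by (simp del: power_Suc)
  also have "\<dots> = (\<Sum>i\<le>degree p. coeff p i * (real i * (\<integral>x. x ^ (i - 1) \<partial>std_normal_distribution)))"
    unfolding stein_power ..
  also have "\<dots> = (\<integral>x. (\<Sum>i\<le>degree p. coeff p i * (real i * x ^ (i - 1))) \<partial>std_normal_distribution)"
    using int by simp
  \<comment> \<open>Both sides are derivatives of \<open>poly p\<close>, so uniqueness of the
    derivative identifies them without comparing coefficients.\<close>
  also have "(\<lambda>x. \<Sum>i\<le>degree p. coeff p i * (real i * x ^ (i - 1))) = poly (pderiv p)"
  proof
    fix x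
    have "((\<lambda>x. poly p x) has_real_derivative (\<Sum>i\<le>degree p. coeff p i * (real i * x ^ (i - 1)))) (at x)"
      unfolding poly_altdef by (auto intro!: derivative_eq_intros sum.cong)
    then show "(\<Sum>i\<le>degree p. coeff p i * (real i * x ^ (i - 1))) = poly (pderiv p) x"
      using poly_DERIV DERIV_unique by blast
  qed
  finally show ?thesis .
qed

text \<open>Split off the constant coefficient and apply Stein's identity to the rest. Each use
  lowers the degree by two, so repeated rewriting evaluates the mean of any concrete
  polynomial.\<close>

lemma std_normal_mean_pCons:
  "(\<integral>x. poly (pCons a p) x \<partial>std_normal_distribution) = a + (\<integral>x. poly (pderiv p) x \<partial>std_normal_distribution)"
proof -
  interpret prob_space std_normal_distribution
    by (rule prob_space_normal_density) simp
  have "integrable std_normal_distribution (\<lambda>x. x * poly p x)"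
    using integrable_std_normal_poly[of "pCons 0 p"] by (simp add: poly_pCons[abs_def])
  then show ?thesis
    using prob_space by (simp add: stein_poly)
qed

section \<open>Wick's rule for Gaussian means\<close>

definition gaussian_mean :: "'d::finite multiset \<Rightarrow> 'd \<Rightarrow> real poly \<Rightarrow> real" where
  "gaussian_mean M i p = integral\<^sup>L std_normal_vec (\<lambda>x :: real ^ 'd. (\<Prod>j\<in>#M. x $ j) * poly p (x $ i))"

text \<open>The factor of the integrand that depends on coordinate \<open>j\<close>. The multiset
  \<open>M\<close> lists the indices of the monomial, so multiplicities are exponents and the order
  of the indices is immaterial.\<close>

definition coord_poly :: "'d multiset \<Rightarrow> 'd \<Rightarrow> real poly \<Rightarrow> 'd \<Rightarrow> real poly" where
  "coord_poly M i p j = monom 1 (count M j) * (if j = i then p else 1)"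

lemma prod_coord_poly:
  fixes x :: "real ^ 'd"
  shows "(\<Prod>j\<in>#M. x $ j) * poly p (x $ i) = (\<Prod>j\<in>UNIV. poly (coord_poly M i p j) (x $ j))"
proof -
  have "(\<Prod>j\<in>#M. x $ j) = (\<Prod>j\<in>set_mset M. (x $ j) ^ count M j)"
    by (rule image_prod_mset_multiplicity)
  also have "\<dots> = (\<Prod>j\<in>UNIV. (x $ j) ^ count M j)"
    by (rule prod.mono_neutral_left) (auto simp: not_in_iff)
  finally have "(\<Prod>j\<in>#M. x $ j) * poly p (x $ i)
      = (\<Prod>j\<in>UNIV. (x $ j) ^ count M j) * (\<Prod>j\<in>UNIV. if j = i then poly p (x $ j) else 1)"
    by simp
  also have "\<dots> = (\<Prod>j\<in>UNIV. poly (coord_poly M i p j) (x $ j))"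
    unfolding prod.distrib[symmetric] by (intro prod.cong) (auto simp: coord_poly_def poly_monom)
  finally show ?thesis .
qed

lemma integrable_gaussian_mean:
  "integrable std_normal_vec (\<lambda>x :: real ^ 'd. (\<Prod>j\<in>#M. x $ j) * poly p (x $ i))"
  unfolding prod_coord_poly by (intro integrable_std_normal_vec_prod integrable_std_normal_poly)

lemma gaussian_mean_prod:
  "gaussian_mean M i p = (\<Prod>j\<in>UNIV. \<integral>t. poly (coord_poly M i p j) t \<partial>std_normal_distribution)"
  unfolding gaussian_mean_def prod_coord_poly
  by (intro integral_std_normal_vec_prod integrable_std_normal_poly)

lemma gaussian_mean_empty:
  "gaussian_mean {#} i p = (\<integral>t. poly p t \<partial>std_normal_distribution)"
proof -
  interpret prob_space std_normal_distribution
    by (rule prob_space_normal_density) simp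
  \<comment> \<open>Each coordinate other than \<open>i\<close> contributes the integral of the
    constant 1.\<close>
  have "prob UNIV = 1"
    using prob_space by simp
  then have "(\<integral>t. poly (coord_poly {#} i p j) t \<partial>std_normal_distribution)
      = (if j = i then \<integral>t. poly p t \<partial>std_normal_distribution else 1)" for j
    by (simp add: coord_poly_def)
  then show ?thesis
    by (simp add: gaussian_mean_prod)
qed

text \<open>Stein's identity in coordinate \<open>k\<close>. By the product rule the derivative
  falls either on the power of \<open>x $ k\<close>, which removes one further \<open>k\<close> from
  \<open>M\<close> with its multiplicity as coefficient, or, if \<open>k = i\<close>, on
  \<open>p\<close>. The factors of all other coordinates are unchanged.\<close>

lemma gaussian_mean_add:
  "gaussian_mean (add_mset k M) i p =
    real (count M k) * gaussian_mean (M - {#k#}) i p + of_bool (k = i) * gaussian_mean M i (pderiv p)"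
proof -
  define m where "m p = (\<integral>t. poly p t \<partial>std_normal_distribution)" for p
  have int: "integrable std_normal_distribution (poly p)" for p
    by (rule integrable_std_normal_poly)
  have monom_real: "monom (real c) n = smult (real c) (monom 1 n)" for c n
    by (simp add: smult_monom)
  have split: "gaussian_mean N j q = m (coord_poly N j q k) * (\<Prod>l\<in>UNIV - {k}. m (coord_poly N j q l))"
    for N j q
    unfolding gaussian_mean_prod m_def by (rule prod.remove) auto
  have "m (coord_poly (add_mset k M) i p k) = m (pCons 0 (coord_poly M i p k))"
    by (simp add: coord_poly_def monom_Suc)
  also have "\<dots> = m (pderiv (coord_poly M i p k))"
    unfolding m_def std_normal_mean_pCons by simp
  also have "pderiv (coord_poly M i p k) =
      smult (real (count M k)) (coord_poly (M - {#k#}) i p k) + (if k = i then coord_poly M i (pderiv p) k else 0)"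
    by (simp add: coord_poly_def pderiv_mult pderiv_monom monom_real mult.commute)
  also have "m \<dots> = real (count M k) * m (coord_poly (M - {#k#}) i p k)
      + of_bool (k = i) * m (coord_poly M i (pderiv p) k)"
    using int by (simp add: m_def poly_0[abs_def])
  finally have "m (coord_poly (add_mset k M) i p k) = real (count M k) * m (coord_poly (M - {#k#}) i p k)
      + of_bool (k = i) * m (coord_poly M i (pderiv p) k)" .
  moreover have "(\<Prod>l\<in>UNIV - {k}. m (coord_poly (add_mset k M) i p l)) = (\<Prod>l\<in>UNIV - {k}. m (coord_poly M i p l))"
    "(\<Prod>l\<in>UNIV - {k}. m (coord_poly (M - {#k#}) i p l)) = (\<Prod>l\<in>UNIV - {k}. m (coord_poly M i p l))"
    "k = i \<Longrightarrow> (\<Prod>l\<in>UNIV - {k}. m (coord_poly M i (pderiv p) l)) = (\<Prod>l\<in>UNIV - {k}. m (coord_poly M i p l))"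
    by (auto intro!: prod.cong simp: coord_poly_def)
  ultimately show ?thesis
    unfolding split by (cases "k = i") (simp_all add: algebra_simps)
qed

lemma gaussian_mean_1: "gaussian_mean {#k#} i p = of_bool (k = i) * gaussian_mean {#} i (pderiv p)"
  by (simp add: gaussian_mean_add)

lemma gaussian_mean_2:
  "gaussian_mean {#k, l#} i p = of_bool (k = l) * gaussian_mean {#} i p
    + of_bool (k = i) * of_bool (l = i) * gaussian_mean {#} i (pderiv (pderiv p))"
  unfolding gaussian_mean_add[of k "{#l#}"] by (simp add: gaussian_mean_1)

text \<open>The multiplicity of \<open>k\<close> is written as one delta per listed index, so that
  each term shows which index \<open>k\<close> is paired with and which ones remain.\<close>

lemma gaussian_mean_3:
  "gaussian_mean {#k, a, b#} i p = of_bool (k = a) * gaussian_mean {#b#} i p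
    + of_bool (k = b) * gaussian_mean {#a#} i p + of_bool (k = i) * gaussian_mean {#a, b#} i (pderiv p)"
  unfolding gaussian_mean_add[of k "{#a, b#}"]
  by (cases "k = a"; cases "k = b") (simp_all add: add_mset_commute)

lemma gaussian_mean_4:
  "gaussian_mean {#k, a, b, c#} i p = of_bool (k = a) * gaussian_mean {#b, c#} i p
    + of_bool (k = b) * gaussian_mean {#a, c#} i p + of_bool (k = c) * gaussian_mean {#a, b#} i p
    + of_bool (k = i) * gaussian_mean {#a, b, c#} i (pderiv p)"
  unfolding gaussian_mean_add[of k "{#a, b, c#}"]
  by (cases "k = a"; cases "k = b"; cases "k = c") (simp_all add: add_mset_commute)

section \<open>Contraction of the Wick terms with one and two copies of \<open>A\<close>\<close>

lemma inner_matrix_vector_mult: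
  fixes A :: "real ^ 'd ^ 'd"
  shows "x \<bullet> (A *v x) = (\<Sum>k\<in>UNIV. \<Sum>l\<in>UNIV. A $ k $ l * (x $ k * x $ l))"
  by (simp add: inner_vec_def matrix_vector_mult_def sum_distrib_left mult_ac)

lemma
  fixes A :: "real ^ 'd ^ 'd"
  shows integrable_quadratic_form: "integrable std_normal_vec (\<lambda>x. (x \<bullet> (A *v x)) * poly p (x $ i))"
    and integral_quadratic_form: "(\<integral>x. (x \<bullet> (A *v x)) * poly p (x $ i) \<partial>std_normal_vec) =
      (\<Sum>k\<in>UNIV. \<Sum>l\<in>UNIV. A $ k $ l * gaussian_mean {#k, l#} i p)"
proof -
  have int: "integrable std_normal_vec (\<lambda>x. x $ k * x $ l * poly p (x $ i))" for k l
    using integrable_gaussian_mean[of "{#k, l#}" p i] by (simp add: mult.assoc)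
  have eq: "(x \<bullet> (A *v x)) * poly p (x $ i) =
    (\<Sum>k\<in>UNIV. \<Sum>l\<in>UNIV. A $ k $ l * (x $ k * x $ l * poly p (x $ i)))" for x
    by (simp add: inner_matrix_vector_mult sum_distrib_right mult.assoc)
  show "integrable std_normal_vec (\<lambda>x. (x \<bullet> (A *v x)) * poly p (x $ i))"
    unfolding eq using int by simp
  show "(\<integral>x. (x \<bullet> (A *v x)) * poly p (x $ i) \<partial>std_normal_vec) =
      (\<Sum>k\<in>UNIV. \<Sum>l\<in>UNIV. A $ k $ l * gaussian_mean {#k, l#} i p)"
    unfolding eq using int by (simp add: gaussian_mean_def)
qed

text \<open>The second copy of \<open>A\<close> is nested inside the first, so that \<open>m\<close>
  and \<open>n\<close> can be contracted while \<open>k\<close> and \<open>l\<close> stay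
  fixed.\<close>

lemma
  fixes A :: "real ^ 'd ^ 'd"
  shows integrable_quadratic_form_power2:
      "integrable std_normal_vec (\<lambda>x. (x \<bullet> (A *v x))\<^sup>2 * poly p (x $ i))"
    and integral_quadratic_form_power2: "(\<integral>x. (x \<bullet> (A *v x))\<^sup>2 * poly p (x $ i) \<partial>std_normal_vec) =
      (\<Sum>k\<in>UNIV. \<Sum>l\<in>UNIV. A $ k $ l *
        (\<Sum>m\<in>UNIV. \<Sum>n\<in>UNIV. A $ m $ n * gaussian_mean {#k, l, m, n#} i p))"
proof -
  have int: "integrable std_normal_vec (\<lambda>x. x $ k * x $ l * x $ m * x $ n * poly p (x $ i))" for k l m n
    using integrable_gaussian_mean[of "{#k, l, m, n#}" p i] by (simp add: mult.assoc)
  have eq: "(x \<bullet> (A *v x))\<^sup>2 * poly p (x $ i) =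
    (\<Sum>k\<in>UNIV. \<Sum>l\<in>UNIV. A $ k $ l *
      (\<Sum>m\<in>UNIV. \<Sum>n\<in>UNIV. A $ m $ n * (x $ k * x $ l * x $ m * x $ n * poly p (x $ i))))" for x
  proof -
    have "(\<Sum>m\<in>UNIV. \<Sum>n\<in>UNIV. A $ m $ n * (x $ k * x $ l * x $ m * x $ n * poly p (x $ i)))
        = x $ k * x $ l * ((x \<bullet> (A *v x)) * poly p (x $ i))" for k l
      by (simp add: inner_matrix_vector_mult sum_distrib_left sum_distrib_right mult_ac)
    then have "(\<Sum>k\<in>UNIV. \<Sum>l\<in>UNIV. A $ k $ l *
      (\<Sum>m\<in>UNIV. \<Sum>n\<in>UNIV. A $ m $ n * (x $ k * x $ l * x $ m * x $ n * poly p (x $ i))))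
      = (\<Sum>k\<in>UNIV. \<Sum>l\<in>UNIV. A $ k $ l * (x $ k * x $ l)) * ((x \<bullet> (A *v x)) * poly p (x $ i))"
      by (simp add: sum_distrib_right mult.assoc)
    then show ?thesis
      by (simp add: inner_matrix_vector_mult[of x A, symmetric] power2_eq_square mult.assoc)
  qed
  show "integrable std_normal_vec (\<lambda>x. (x \<bullet> (A *v x))\<^sup>2 * poly p (x $ i))"
    unfolding eq using int by simp
  show "(\<integral>x. (x \<bullet> (A *v x))\<^sup>2 * poly p (x $ i) \<partial>std_normal_vec) =
      (\<Sum>k\<in>UNIV. \<Sum>l\<in>UNIV. A $ k $ l *
        (\<Sum>m\<in>UNIV. \<Sum>n\<in>UNIV. A $ m $ n * gaussian_mean {#k, l, m, n#} i p))"
    unfolding eq using int by (simp add: gaussian_mean_def mult.assoc)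
qed

lemma sum_of_bool_eq_mult:
  fixes f :: "'d::finite \<Rightarrow> real"
  shows "(\<Sum>k\<in>UNIV. of_bool (k = l) * f k) = f l" "(\<Sum>k\<in>UNIV. of_bool (l = k) * f k) = f l"
  by (simp_all add: of_bool_def if_distribR if_distrib cong: if_cong)

text \<open>Pairing the two indices with each other produces the trace; matching both with
  \<open>i\<close> selects a diagonal entry and differentiates \<open>p\<close> twice.\<close>

lemma sum_gaussian_mean_2:
  fixes A :: "real ^ 'd ^ 'd"
  shows "(\<Sum>k\<in>UNIV. \<Sum>l\<in>UNIV. A $ k $ l * gaussian_mean {#k, l#} i p) =
    trace A * gaussian_mean {#} i p + A $ i $ i * gaussian_mean {#} i (pderiv (pderiv p))"
proof -
  have "(\<Sum>l\<in>UNIV. A $ k $ l * gaussian_mean {#k, l#} i p) =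
    A $ k $ k * gaussian_mean {#} i p + of_bool (k = i) * (A $ k $ i * gaussian_mean {#} i (pderiv (pderiv p)))" for k
    using sum_of_bool_eq_mult(2)[of k "\<lambda>l. A $ k $ l * gaussian_mean {#} i p"]
      sum_of_bool_eq_mult(1)[of i "\<lambda>l. of_bool (k = i) * (A $ k $ l * gaussian_mean {#} i (pderiv (pderiv p)))"]
    by (simp add: gaussian_mean_2 sum.distrib distrib_left mult.left_commute)
  then show ?thesis
    by (simp add: sum.distrib sum_of_bool_eq_mult trace_def sum_distrib_right)
qed

text \<open>The ten Wick terms, grouped by the fate of \<open>k\<close> and \<open>l\<close>. If
  these are paired with each other or both absorbed by \<open>p\<close>, the pair \<open>m\<close>,
  \<open>n\<close> is left unexpanded; in the six other terms deltas fix \<open>m\<close> and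
  \<open>n\<close>. These deltas are oriented and ordered to collapse the sum over \<open>n\<close>
  first, then that over \<open>m\<close>.\<close>

lemma gaussian_mean_4_deltas:
  "gaussian_mean {#k, l, m, n#} i p = of_bool (k = l) * gaussian_mean {#m, n#} i p
    + of_bool (k = i) * of_bool (l = i) * gaussian_mean {#m, n#} i (pderiv (pderiv p))
    + of_bool (n = l) * (of_bool (m = k) * gaussian_mean {#} i p)
    + of_bool (n = k) * (of_bool (m = l) * gaussian_mean {#} i p)
    + of_bool (n = l) * (of_bool (m = i) * (of_bool (k = i) * gaussian_mean {#} i (pderiv (pderiv p))))
    + of_bool (n = k) * (of_bool (m = i) * (of_bool (l = i) * gaussian_mean {#} i (pderiv (pderiv p))))
    + of_bool (n = i) * (of_bool (m = l) * (of_bool (k = i) * gaussian_mean {#} i (pderiv (pderiv p))))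
    + of_bool (n = i) * (of_bool (m = k) * (of_bool (l = i) * gaussian_mean {#} i (pderiv (pderiv p))))"
  unfolding gaussian_mean_4 gaussian_mean_3 gaussian_mean_2 gaussian_mean_1
    eq_commute[of l m] eq_commute[of l n] eq_commute[of k m] eq_commute[of k n]
  by (simp add: algebra_simps)

text \<open>Kept as sums \<open>T\<close> over the remaining pair, so that the second contraction can reuse
  \<open>sum_gaussian_mean_2\<close>.\<close>

lemma sum_gaussian_mean_4:
  fixes A :: "real ^ 'd ^ 'd"
  defines "T \<equiv> (\<lambda>i p. \<Sum>k\<in>UNIV. \<Sum>l\<in>UNIV. A $ k $ l * gaussian_mean {#k, l#} i p)"
  shows "(\<Sum>m\<in>UNIV. \<Sum>n\<in>UNIV. A $ m $ n * gaussian_mean {#k, l, m, n#} i p) =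
    of_bool (k = l) * T i p + of_bool (k = i) * of_bool (l = i) * T i (pderiv (pderiv p))
  + (A $ k $ l + A $ l $ k) * gaussian_mean {#} i p
  + (of_bool (k = i) * (A $ i $ l + A $ l $ i) + of_bool (l = i) * (A $ i $ k + A $ k $ i))
     * gaussian_mean {#} i (pderiv (pderiv p))"
proof -
  have pull: "(\<Sum>m\<in>UNIV. \<Sum>n\<in>UNIV. A $ m $ n * (c * f m n)) = c * (\<Sum>m\<in>UNIV. \<Sum>n\<in>UNIV. A $ m $ n * f m n)" for c f
    by (simp add: sum_distrib_left mult_ac)
  have delta: "(\<Sum>m\<in>UNIV. \<Sum>n\<in>UNIV. A $ m $ n * (of_bool (n = b) * (of_bool (m = a) * c))) = A $ a $ b * c" for a b c
  proof -
    have "A $ m $ n * (of_bool (n = b) * (of_bool (m = a) * c))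
        = of_bool (n = b) * (of_bool (m = a) * (A $ m $ n * c))" for m n
      by simp
    then show ?thesis
      by (simp only: sum_of_bool_eq_mult)
  qed
  show ?thesis
    unfolding gaussian_mean_4_deltas distrib_left sum.distrib delta pull T_def mult.assoc
    by (simp add: algebra_simps)
qed

lemma frobenius_norm_symmetrized:
  "(frobenius_norm (A + transpose A))\<^sup>2 = (\<Sum>k\<in>UNIV. \<Sum>l\<in>UNIV. (A $ k $ l + A $ l $ k)\<^sup>2)"
  by (simp add: frobenius_norm_eq_norm norm_vec_def L2_set_def sum_nonneg transpose_def)

text \<open>Swapping the summation indices replaces the weight \<open>A $ k $ l\<close> by
  \<open>A $ l $ k\<close>; the two equal sums add up to the full square.\<close>

lemma sum_mult_symmetrized:
  fixes A :: "real ^ 'd ^ 'd"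
  shows "(\<Sum>k\<in>UNIV. \<Sum>l\<in>UNIV. A $ k $ l * (A $ k $ l + A $ l $ k)) = (frobenius_norm (A + transpose A))\<^sup>2 / 2"
proof -
  have "(\<Sum>k\<in>UNIV. \<Sum>l\<in>UNIV. A $ k $ l * (A $ k $ l + A $ l $ k)) =
      (\<Sum>k\<in>UNIV. \<Sum>l\<in>UNIV. A $ l $ k * (A $ k $ l + A $ l $ k))"
    by (subst sum.swap) (simp add: add.commute)
  moreover have "(frobenius_norm (A + transpose A))\<^sup>2 =
      (\<Sum>k\<in>UNIV. \<Sum>l\<in>UNIV. A $ k $ l * (A $ k $ l + A $ l $ k)) +
      (\<Sum>k\<in>UNIV. \<Sum>l\<in>UNIV. A $ l $ k * (A $ k $ l + A $ l $ k))"
    unfolding frobenius_norm_symmetrized sum.distrib[symmetric] by (simp add: power2_eq_square distrib_right)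
  ultimately show ?thesis
    by simp
qed

text \<open>Contracting \<open>k\<close> and \<open>l\<close> in \<open>sum_gaussian_mean_4\<close>:
  the first two summands are those where \<open>k\<close> and \<open>l\<close> are paired together
  or both absorbed by \<open>p\<close>, the third comes from the two crossed pairings, and the last
  from one crossed pair with the other two indices absorbed.\<close>

lemma integral_quadratic_form_power2_eq:
  fixes A :: "real ^ 'd ^ 'd" and p :: "real poly" and i :: 'd
  defines "T \<equiv> (\<lambda>p. \<Sum>k\<in>UNIV. \<Sum>l\<in>UNIV. A $ k $ l * gaussian_mean {#k, l#} i p)"
  shows "(\<integral>x. (x \<bullet> (A *v x))\<^sup>2 * poly p (x $ i) \<partial>std_normal_vec) =
    trace A * T p + A $ i $ i * T (pderiv (pderiv p))
    + (frobenius_norm (A + transpose A))\<^sup>2 / 2 * gaussian_mean {#} i p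
    + (\<Sum>k\<in>UNIV. (A $ i $ k + A $ k $ i)\<^sup>2) * gaussian_mean {#} i (pderiv (pderiv p))"
proof -
  define g0 where "g0 = gaussian_mean {#} i p"
  define g2 where "g2 = gaussian_mean {#} i (pderiv (pderiv p))"
  define B where "B k = A $ i $ k + A $ k $ i" for k
  have "(\<Sum>l\<in>UNIV. A $ k $ l * (\<Sum>m\<in>UNIV. \<Sum>n\<in>UNIV. A $ m $ n * gaussian_mean {#k, l, m, n#} i p)) =
      A $ k $ k * T p
    + of_bool (k = i) * (A $ k $ i * T (pderiv (pderiv p)))
    + (\<Sum>l\<in>UNIV. A $ k $ l * (A $ k $ l + A $ l $ k)) * g0
    + of_bool (k = i) * ((\<Sum>l\<in>UNIV. A $ k $ l * B l) * g2) + A $ k $ i * B k * g2" (is "?L k = ?R k") for k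
  proof -
    have "?L k = (\<Sum>l\<in>UNIV. of_bool (k = l) * (A $ k $ l * T p))
      + (\<Sum>l\<in>UNIV. of_bool (l = i) * (of_bool (k = i) * (A $ k $ l * T (pderiv (pderiv p)))))
      + (\<Sum>l\<in>UNIV. A $ k $ l * (A $ k $ l + A $ l $ k) * g0)
      + (\<Sum>l\<in>UNIV. of_bool (k = i) * (A $ k $ l * B l * g2))
      + (\<Sum>l\<in>UNIV. of_bool (l = i) * (A $ k $ l * B k * g2))"
      unfolding sum_gaussian_mean_4 sum.distrib[symmetric]
      by (intro sum.cong) (simp_all add: T_def B_def g0_def g2_def algebra_simps)
    then show ?thesis
      by (simp only: sum_of_bool_eq_mult sum_distrib_left[symmetric] sum_distrib_right[symmetric])
  qed
  then have "(\<integral>x. (x \<bullet> (A *v x))\<^sup>2 * poly p (x $ i) \<partial>std_normal_vec) = (\<Sum>k\<in>UNIV. ?R k)"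
    unfolding integral_quadratic_form_power2 by simp
  also have "\<dots> = trace A * T p + A $ i $ i * T (pderiv (pderiv p))
    + (frobenius_norm (A + transpose A))\<^sup>2 / 2 * g0
    + ((\<Sum>k\<in>UNIV. A $ i $ k * B k) + (\<Sum>k\<in>UNIV. A $ k $ i * B k)) * g2"
    by (simp only: sum.distrib sum_of_bool_eq_mult sum_distrib_right[symmetric] sum_mult_symmetrized
        trace_def distrib_right add.assoc)
  \<comment> \<open>Row \<open>i\<close> and column \<open>i\<close> of \<open>A\<close> carry the
    same weights \<open>B\<close>, so together they form the squared entries of row \<open>i\<close>
    of \<open>A + transpose A\<close>.\<close>
  also have "(\<Sum>k\<in>UNIV. A $ i $ k * B k) + (\<Sum>k\<in>UNIV. A $ k $ i * B k) = (\<Sum>k\<in>UNIV. (A $ i $ k + A $ k $ i)\<^sup>2)"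
    unfolding sum.distrib[symmetric] by (simp add: B_def power2_eq_square distrib_right)
  finally show ?thesis
    unfolding g0_def g2_def .
qed

lemma gaussian_mean_empty_pCons:
  "gaussian_mean {#} i (pCons a p) = a + gaussian_mean {#} i (pderiv p)"
  unfolding gaussian_mean_empty by (rule std_normal_mean_pCons)

lemma gaussian_mean_zero: "gaussian_mean M i 0 = 0"
  by (simp add: gaussian_mean_def)

section \<open>Moments of a single sample and of its error\<close>

lemma
  fixes A :: "real ^ 'd ^ 'd"
  shows integrable_diag_sample: "integrable std_normal_vec (\<lambda>x. (x \<bullet> (A *v x)) * ((x $ i)\<^sup>2 - 1))"
    and integral_diag_sample: "(\<integral>x. (x \<bullet> (A *v x)) * ((x $ i)\<^sup>2 - 1) \<partial>std_normal_vec) = 2 * A $ i $ i"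
proof -
  have eq: "(x $ i)\<^sup>2 - 1 = poly [:-1, 0, 1:] (x $ i)" for x :: "real ^ 'd"
    by (simp add: power2_eq_square)
  show "integrable std_normal_vec (\<lambda>x. (x \<bullet> (A *v x)) * ((x $ i)\<^sup>2 - 1))"
    unfolding eq by (rule integrable_quadratic_form)
  \<comment> \<open>The polynomial \<open>t^2 - 1\<close> has mean 0, which removes the trace, and
    second derivative 2, which accounts for the factor 2 undone by the estimator's
    normalisation.\<close>
  show "(\<integral>x. (x \<bullet> (A *v x)) * ((x $ i)\<^sup>2 - 1) \<partial>std_normal_vec) = 2 * A $ i $ i"
    unfolding eq integral_quadratic_form sum_gaussian_mean_2
    by (simp add: gaussian_mean_empty_pCons gaussian_mean_zero pderiv_pCons)
qed

lemma
  fixes A :: "real ^ 'd ^ 'd"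
  shows integrable_diag_sample_power2:
      "integrable std_normal_vec (\<lambda>x. ((x \<bullet> (A *v x)) * ((x $ i)\<^sup>2 - 1))\<^sup>2)"
    and integral_diag_sample_power2:
      "(\<integral>x. ((x \<bullet> (A *v x)) * ((x $ i)\<^sup>2 - 1))\<^sup>2 \<partial>std_normal_vec) =
        2 * (trace A)\<^sup>2 + 16 * trace A * A $ i $ i + 24 * (A $ i $ i)\<^sup>2
        + (frobenius_norm (A + transpose A))\<^sup>2 + 8 * (\<Sum>k\<in>UNIV. (A $ i $ k + A $ k $ i)\<^sup>2)"
proof -
  \<comment> \<open>The polynomial is \<open>(t^2 - 1)^2\<close>. Its mean and those of its second
    and fourth derivatives are 2, 8 and 24; the mixed product \<open>trace A * A $ i $ i\<close>
    arises twice with coefficient 8, hence 16.\<close>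
  have eq: "((x \<bullet> (A *v x)) * ((x $ i)\<^sup>2 - 1))\<^sup>2 = (x \<bullet> (A *v x))\<^sup>2 * poly [:1, 0, -2, 0, 1:] (x $ i)" for x
    by (simp add: power_mult_distrib) (simp add: power2_eq_square algebra_simps)
  show "integrable std_normal_vec (\<lambda>x. ((x \<bullet> (A *v x)) * ((x $ i)\<^sup>2 - 1))\<^sup>2)"
    unfolding eq by (rule integrable_quadratic_form_power2)
  show "(\<integral>x. ((x \<bullet> (A *v x)) * ((x $ i)\<^sup>2 - 1))\<^sup>2 \<partial>std_normal_vec) =
        2 * (trace A)\<^sup>2 + 16 * trace A * A $ i $ i + 24 * (A $ i $ i)\<^sup>2
        + (frobenius_norm (A + transpose A))\<^sup>2 + 8 * (\<Sum>k\<in>UNIV. (A $ i $ k + A $ k $ i)\<^sup>2)"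
    unfolding eq integral_quadratic_form_power2_eq sum_gaussian_mean_2
    by (simp add: gaussian_mean_empty_pCons gaussian_mean_zero pderiv_pCons power2_eq_square algebra_simps)
qed

text \<open>The coordinate-\<open>i\<close> error of the estimate from one sample, centred because
  the undivided product has mean \<open>2 * A $ i $ i\<close>.\<close>

definition diag_error :: "real ^ 'd ^ 'd \<Rightarrow> 'd \<Rightarrow> real ^ 'd \<Rightarrow> real" where
  "diag_error A i x = (x \<bullet> (A *v x)) * ((x $ i)\<^sup>2 - 1) / 2 - A $ i $ i"

lemma prob_space_std_normal_vec: "prob_space (std_normal_vec :: (real ^ 'd) measure)"
proof
  have "emeasure std_normal_vec (space (std_normal_vec :: (real ^ 'd) measure)) =
    (\<integral>\<^sup>+ x. ennreal (\<Prod>i\<in>UNIV. std_normal_density ((x :: real ^ 'd) $ i)) \<partial>lborel)"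
    by (simp add: emeasure_density std_normal_vec_density_eq_prod)
  also have "\<dots> = ennreal (\<integral>x. (\<Prod>i\<in>UNIV. std_normal_density ((x :: real ^ 'd) $ i)) \<partial>lborel)"
    by (intro nn_integral_eq_integral integrable_lborel_vec_prod) (simp_all add: prod_nonneg)
  also have "\<dots> = 1"
    by (subst integral_lborel_vec_prod) simp_all
  finally show "emeasure std_normal_vec (space (std_normal_vec :: (real ^ 'd) measure)) = 1" .
qed

lemma
  fixes A :: "real ^ 'd ^ 'd"
  shows integrable_diag_error: "integrable std_normal_vec (diag_error A i)"
    and integral_diag_error: "integral\<^sup>L std_normal_vec (diag_error A i) = 0"
    and integrable_diag_error_power2: "integrable std_normal_vec (\<lambda>x. (diag_error A i x)\<^sup>2)"
    and sum_integral_diag_error_power2: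
      "(\<Sum>i\<in>UNIV. \<integral>x. (diag_error A i x)\<^sup>2 \<partial>std_normal_vec) =
        ((2 * real CARD('d) + 16) * (trace A)\<^sup>2
         + (real CARD('d) + 8) * (frobenius_norm (A + transpose A))\<^sup>2
         + 20 * (\<Sum>i\<in>UNIV. (A $ i $ i)\<^sup>2)) / 4"
proof -
  interpret prob_space "std_normal_vec :: (real ^ 'd) measure"
    by (rule prob_space_std_normal_vec)
  have "prob UNIV = 1"
    using prob_space by simp
  note int = integrable_diag_sample[of A] integrable_diag_sample_power2[of A]
  \<comment> \<open>In expectation the last two terms add up to \<open>- (A $ i $ i)^2\<close>,
    which over the common denominator 4 turns the coefficient 24 into 20.\<close>
  have sq: "(diag_error A i x)\<^sup>2 = ((x \<bullet> (A *v x)) * ((x $ i)\<^sup>2 - 1))\<^sup>2 / 4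
      - A $ i $ i * ((x \<bullet> (A *v x)) * ((x $ i)\<^sup>2 - 1)) + (A $ i $ i)\<^sup>2" for i x
    by (simp add: diag_error_def power2_eq_square field_simps)
  show "integrable std_normal_vec (diag_error A i)"
    unfolding diag_error_def[abs_def] using int by simp
  show "integral\<^sup>L std_normal_vec (diag_error A i) = 0"
    unfolding diag_error_def[abs_def] using int \<open>prob UNIV = 1\<close> by (simp add: integral_diag_sample)
  show "integrable std_normal_vec (\<lambda>x. (diag_error A i x)\<^sup>2)"
    unfolding sq using int by simp
  have "(\<integral>x. (diag_error A i x)\<^sup>2 \<partial>std_normal_vec) =
    (2 * (trace A)\<^sup>2 + 16 * trace A * A $ i $ i + 20 * (A $ i $ i)\<^sup>2
        + (frobenius_norm (A + transpose A))\<^sup>2 + 8 * (\<Sum>k\<in>UNIV. (A $ i $ k + A $ k $ i)\<^sup>2)) / 4" for i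
    unfolding sq using int \<open>prob UNIV = 1\<close>
    by (simp add: integral_diag_sample integral_diag_sample_power2) (simp add: power2_eq_square field_simps)
  then have "(\<Sum>i\<in>UNIV. \<integral>x. (diag_error A i x)\<^sup>2 \<partial>std_normal_vec) =
    (\<Sum>i\<in>UNIV. 2 * (trace A)\<^sup>2 + 16 * trace A * A $ i $ i + 20 * (A $ i $ i)\<^sup>2
        + (frobenius_norm (A + transpose A))\<^sup>2 + 8 * (\<Sum>k\<in>UNIV. (A $ i $ k + A $ k $ i)\<^sup>2)) / 4"
    by (simp only: sum_divide_distrib)
  \<comment> \<open>Terms independent of \<open>i\<close> acquire the factor
    \<open>CARD('d)\<close>, the diagonal entries sum to the trace, and the row sums assemble into
    the squared Frobenius norm; hence \<open>2 d + 16\<close> and \<open>d + 8\<close>.\<close>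
  then show "(\<Sum>i\<in>UNIV. \<integral>x. (diag_error A i x)\<^sup>2 \<partial>std_normal_vec) =
        ((2 * real CARD('d) + 16) * (trace A)\<^sup>2
         + (real CARD('d) + 8) * (frobenius_norm (A + transpose A))\<^sup>2
         + 20 * (\<Sum>i\<in>UNIV. (A $ i $ i)\<^sup>2)) / 4"
    by (simp add: sum.distrib sum_distrib_left[symmetric]
        frobenius_norm_symmetrized trace_def[symmetric])
      (simp add: power2_eq_square algebra_simps)
qed

section \<open>Averaging independent samples and Markov's inequality\<close>

lemma (in prob_space)
  fixes Y :: "'i \<Rightarrow> 'a \<Rightarrow> real"
  assumes "finite I" and indep: "indep_vars (\<lambda>_. borel) Y I"
    and int: "\<And>i. i \<in> I \<Longrightarrow> integrable M (Y i)" "\<And>i. i \<in> I \<Longrightarrow> integrable M (\<lambda>\<omega>. (Y i \<omega>)\<^sup>2)"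
    and mean: "\<And>i. i \<in> I \<Longrightarrow> expectation (Y i) = 0"
  shows integrable_indep_sum_power2: "integrable M (\<lambda>\<omega>. (\<Sum>i\<in>I. Y i \<omega>)\<^sup>2)"
    and expectation_indep_sum_power2:
      "expectation (\<lambda>\<omega>. (\<Sum>i\<in>I. Y i \<omega>)\<^sup>2) = (\<Sum>i\<in>I. expectation (\<lambda>\<omega>. (Y i \<omega>)\<^sup>2))"
proof -
  have pair: "indep_vars (\<lambda>_. borel) Y {i, j}" "\<And>k. k \<in> {i, j} \<Longrightarrow> integrable M (Y k)"
    if "i \<in> I" "j \<in> I" for i j
    using indep_vars_subset[OF indep, of "{i, j}"] int(1) that by auto
  have int2: "integrable M (\<lambda>\<omega>. Y i \<omega> * Y j \<omega>)" if "i \<in> I" "j \<in> I" for i j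
    using int(2)[OF that(1)] indep_vars_integrable[OF _ pair[OF that]]
    by (cases "i = j") (simp_all add: power2_eq_square)
  \<comment> \<open>Off the diagonal the expectation factors by independence and vanishes because
    the variables are centred.\<close>
  have cov: "expectation (\<lambda>\<omega>. Y i \<omega> * Y j \<omega>) = (if j = i then expectation (\<lambda>\<omega>. (Y i \<omega>)\<^sup>2) else 0)"
    if "i \<in> I" "j \<in> I" for i j
    using indep_vars_lebesgue_integral[OF _ pair[OF that]] mean that
    by (cases "i = j") (simp_all add: power2_eq_square)
  have eq: "(\<Sum>i\<in>I. Y i \<omega>)\<^sup>2 = (\<Sum>i\<in>I. \<Sum>j\<in>I. Y i \<omega> * Y j \<omega>)" for \<omega>
    by (simp add: power2_eq_square sum_product)
  show "integrable M (\<lambda>\<omega>. (\<Sum>i\<in>I. Y i \<omega>)\<^sup>2)"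
    unfolding eq using int2 by (intro Bochner_Integration.integrable_sum) auto
  show "expectation (\<lambda>\<omega>. (\<Sum>i\<in>I. Y i \<omega>)\<^sup>2) = (\<Sum>i\<in>I. expectation (\<lambda>\<omega>. (Y i \<omega>)\<^sup>2))"
    unfolding eq using int2 \<open>finite I\<close> by (simp add: cov)
qed

text \<open>The \<open>N\<close> centring terms \<open>A $ i $ i\<close>, divided by
  \<open>N\<close>, reproduce \<open>diag_vec A\<close>, so the total error is the average of the
  one-sample errors.\<close>

lemma norm_diag_estimator_error:
  fixes A :: "real ^ 'd ^ 'd"
  assumes "N > 0"
  shows "(norm (diag_estimator A N v - diag_vec A))\<^sup>2 = (\<Sum>i\<in>UNIV. (\<Sum>j=1..N. diag_error A i (v j))\<^sup>2) / (real N)\<^sup>2"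
proof -
  have "(diag_estimator A N v - diag_vec A) $ i = (\<Sum>j=1..N. diag_error A i (v j)) / real N" for i
    using assms
    by (simp add: diag_estimator_def diag_vec_def diag_error_def sum_subtractf sum.distrib sum_divide_distrib[symmetric] field_simps)
  then have "(norm (diag_estimator A N v - diag_vec A))\<^sup>2 = (\<Sum>i\<in>UNIV. ((\<Sum>j=1..N. diag_error A i (v j)) / real N)\<^sup>2)"
    by (simp add: norm_vec_def L2_set_def sum_nonneg power_divide del: vector_minus_component)
  then show ?thesis
    by (simp add: power_divide sum_divide_distrib[symmetric])
qed

theorem theorem2:
  fixes A :: "real ^ 'd ^ 'd"
    and P :: "'a measure"
    and u :: "nat \<Rightarrow> 'a \<Rightarrow> real ^ 'd"
    and g :: "'a \<Rightarrow> real ^ 'd"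
    and N :: nat
    and \<delta> \<epsilon> :: real
  assumes "(\<Sum>i\<in>UNIV. (A $ i $ i)\<^sup>2) > 0"
    and "N > 0"
    and "prob_space P"
    and "prob_space.indep_vars P (\<lambda>_. borel) u {1..N}"
    and "\<And>j. j \<in> {1..N} \<Longrightarrow> distributed P lborel (u j) (\<lambda>x. ennreal (std_normal_vec_density x))"
    and "g = (\<lambda>\<omega>. diag_estimator A N (\<lambda>j. u j \<omega>))"
    and "0 < \<delta>" and "\<delta> < 1" and "\<epsilon> > 0"
    and "real N = 1 / (4 * \<epsilon> * \<delta>) *
           (((4 * real CARD('d) + 16) * (trace A)\<^sup>2
             + (real CARD('d) + 8) * (frobenius_norm (A + transpose A))\<^sup>2
             + 20 * (\<Sum>i\<in>UNIV. (A $ i $ i)\<^sup>2))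
            / (\<Sum>i\<in>UNIV. (A $ i $ i)\<^sup>2))"
  shows "measure P {\<omega> \<in> space P. (norm (g \<omega> - diag_vec A))\<^sup>2 \<le> \<epsilon> * (\<Sum>i\<in>UNIV. (A $ i $ i)\<^sup>2)}
           \<ge> 1 - \<delta>"
proof -
  interpret prob_space P by fact
  \<comment> \<open>\<open>D\<close> is the scale of the allowed error, \<open>V\<close> the total
    mean squared error of one sample, and \<open>X\<close> the random variable to which Markov's
    inequality is applied.\<close>
  define D where "D = (\<Sum>i\<in>UNIV. (A $ i $ i)\<^sup>2)"
  define V where "V = (\<Sum>i\<in>UNIV. \<integral>x. (diag_error A i x)\<^sup>2 \<partial>std_normal_vec)"
  define X where "X \<omega> = (norm (g \<omega> - diag_vec A))\<^sup>2" for \<omega>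
  have "D > 0"
    using assms(1) by (simp add: D_def)
  have X_eq: "X = (\<lambda>\<omega>. (\<Sum>i\<in>UNIV. (\<Sum>j=1..N. diag_error A i (u j \<omega>))\<^sup>2) / (real N)\<^sup>2)"
    by (simp add: X_def[abs_def] assms(6) norm_diag_estimator_error[OF \<open>N > 0\<close>])
  have meas [measurable]: "diag_error A i \<in> borel_measurable borel" for i
    using borel_measurable_integrable[OF integrable_diag_error[of A i]] by simp
  have u [measurable]: "u j \<in> measurable P lborel" and distr: "distr P lborel (u j) = std_normal_vec"
    if "j \<in> {1..N}" for j
    using distributed_measurable[OF assms(5)[OF that]] distributed_distr_eq_density[OF assms(5)[OF that]]
    by simp_all
  have transfer: "integrable P (\<lambda>\<omega>. f (u j \<omega>)) \<longleftrightarrow> integrable std_normal_vec f"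
    "expectation (\<lambda>\<omega>. f (u j \<omega>)) = integral\<^sup>L std_normal_vec f"
    if "j \<in> {1..N}" "f \<in> borel_measurable borel" for j and f :: "real ^ 'd \<Rightarrow> real"
    unfolding distr[OF that(1), symmetric] using u[OF that(1)] that(2)
    by (simp_all add: integrable_distr_eq integral_distr)
  have indep: "indep_vars (\<lambda>_. borel) (\<lambda>j \<omega>. diag_error A i (u j \<omega>)) {1..N}" for i
    by (rule indep_vars_compose2[OF assms(4)]) simp
  have sq: "integrable P (\<lambda>\<omega>. (\<Sum>j=1..N. diag_error A i (u j \<omega>))\<^sup>2)"
    "expectation (\<lambda>\<omega>. (\<Sum>j=1..N. diag_error A i (u j \<omega>))\<^sup>2) =
      real N * (\<integral>x. (diag_error A i x)\<^sup>2 \<partial>std_normal_vec)" for i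
  proof -
    have *: "integrable P (\<lambda>\<omega>. diag_error A i (u j \<omega>))" "integrable P (\<lambda>\<omega>. (diag_error A i (u j \<omega>))\<^sup>2)"
      "expectation (\<lambda>\<omega>. diag_error A i (u j \<omega>)) = 0"
      "expectation (\<lambda>\<omega>. (diag_error A i (u j \<omega>))\<^sup>2) = (\<integral>x. (diag_error A i x)\<^sup>2 \<partial>std_normal_vec)"
      if "j \<in> {1..N}" for j
      using transfer[OF that, of "diag_error A i"] transfer[OF that, of "\<lambda>x. (diag_error A i x)\<^sup>2"]
        integrable_diag_error[of A i] integral_diag_error[of A i] integrable_diag_error_power2[of A i]
      by simp_all
    show "integrable P (\<lambda>\<omega>. (\<Sum>j=1..N. diag_error A i (u j \<omega>))\<^sup>2)"
      using integrable_indep_sum_power2[OF _ indep] * by simp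
    show "expectation (\<lambda>\<omega>. (\<Sum>j=1..N. diag_error A i (u j \<omega>))\<^sup>2) =
      real N * (\<integral>x. (diag_error A i x)\<^sup>2 \<partial>std_normal_vec)"
      using expectation_indep_sum_power2[OF _ indep] * by simp
  qed
  \<comment> \<open>The variance of the sum grows like \<open>N\<close> while the normalisation
    divides by \<open>(real N)^2\<close>.\<close>
  have int: "integrable P X" and EX: "expectation X = V / real N"
    using sq \<open>N > 0\<close>
    by (simp_all add: X_eq V_def sum_distrib_left[symmetric] power2_eq_square)
  have X_nonneg: "0 \<le> X \<omega>" for \<omega>
    by (simp add: X_def)
  \<comment> \<open>The exact value of \<open>4 * V\<close> falls short of the right-hand side by
    \<open>2 d (trace A)^2\<close>, which is nonnegative.\<close>
  have "4 * V \<le> (4 * real CARD('d) + 16) * (trace A)\<^sup>2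
      + (real CARD('d) + 8) * (frobenius_norm (A + transpose A))\<^sup>2 + 20 * D"
    by (simp add: V_def sum_integral_diag_error_power2 D_def distrib_right)
  \<comment> \<open>The prescribed sample size with its denominators cleared, which is legitimate
    since \<open>D\<close>, \<open>\<epsilon>\<close> and \<open>\<delta>\<close> are
    positive.\<close>
  also have "\<dots> = real N * (4 * \<epsilon> * \<delta>) * D"
    using assms(7,9) \<open>D > 0\<close> by (simp add: assms(10) D_def[symmetric])
  finally have V_le: "V / real N / (\<epsilon> * D) \<le> \<delta>"
    using assms(2,9) \<open>D > 0\<close> by (simp add: divide_simps mult_ac)
  have X_meas [measurable]: "X \<in> borel_measurable P"
    using int by simp
  \<comment> \<open>The failure event is a strict tail; it is enlarged to the closed tail that
    Markov's inequality bounds.\<close>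
  have "prob {\<omega> \<in> space P. \<not> X \<omega> \<le> \<epsilon> * D} \<le> prob {\<omega> \<in> space P. X \<omega> \<ge> \<epsilon> * D}"
    by (rule finite_measure_mono) auto
  also have "\<dots> \<le> expectation X / (\<epsilon> * D)"
    using assms(9) \<open>D > 0\<close> int X_nonneg
    by (intro integral_Markov_inequality_measure[where A = "{}"]) auto
  also have "\<dots> \<le> \<delta>"
    using V_le by (simp add: EX)
  finally have "1 - \<delta> \<le> prob {\<omega> \<in> space P. X \<omega> \<le> \<epsilon> * D}"
    by (subst (asm) prob_neg) simp_all
  then show ?thesis
    by (simp add: X_def D_def)
qed

end
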